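(* The logic $\mathbf{KF}$ is sound and strongly complete with respect to the class $\mathcal{SF}_2$ of all two-sorted bidirectional frames under the window semantics: for each sort $s\in\{s_1,s_2\}$, every set $\Phi$ of $\mathbf{KF}$-formulas of sort $s$ and every $\mathbf{KF}$-formula $\phi$ of sort $s$, $\Phi\vdash^{\mathbf{KF}}_s\phi$ if and only if $\Phi\models^{\mathcal{SF}_2}_s\phi$.
   Context: Sorts $s_1,s_2$ with disjoint nonempty sets $P_{s_1},P_{s_2}$ of propositional variables. $\mathbf{KF}$-formulas: each sort closed under $\neg,\wedge$; $\boxminus\phi$ is of sort $s_2$ for $\phi$ of sort $s_1$; $\boxminus^{-1}\psi$ is of sort $s_1$ for $\psi$ of sort $s_2$. Frames in $\mathcal{SF}_2$: $(W_1,W_2,R,R^{-1})$ with $W_1,W_2$ nonempty disjoint, $R\subseteq W_2\times W_1$, $R^{-1}$ its converse; a model adds $v$ with $v(p)\subseteq W_i$ for $p\in P_{s_i}$. Satisfaction: atoms and Booleans as usual; at $w\in W_2$, $\boxminus\phi$ holds iff for every $w'\in W_1$, $w'\models\phi$ implies $R(w,w')$; at $w\in W_1$, $\boxminus^{-1}\psi$ holds iff for every $w'\in W_2$, $w'\models\psi$ implies $R^{-1}(w,w')$. $\Phi\models^{\mathcal{SF}_2}_s\phi$: in every model on a frame of $\mathcal{SF}_2$, every world of sort $s$ satisfying all of $\Phi$ satisfies $\phi$. $\mathbf{KF}$: axioms are all propositional tautologies of each sort; $\boxminus(\phi_1\wedge\neg\phi_2)\to(\boxminus\neg\phi_1\to\boxminus\neg\phi_2)$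 ($\phi_i$ of sort $s_1$); $\phi\to\boxminus^{-1}\boxminus\phi$ ($\phi$ of sort $s_1$); $\boxminus^{-1}(\psi_1\wedge\neg\psi_2)\to(\boxminus^{-1}\neg\psi_1\to\boxminus^{-1}\neg\psi_2)$ ($\psi_i$ of sort $s_2$); $\psi\to\boxminus\boxminus^{-1}\psi$ ($\psi$ of sort $s_2$). Rules: modus ponens; from $\neg\phi$ infer $\boxminus\phi$; from $\neg\psi$ infer $\boxminus^{-1}\psi$. $\Phi\vdash^{\mathbf{KF}}_s\phi$ means there are $\phi_1,\dots,\phi_n\in\Phi$ with $(\phi_1\wedge\dots\wedge\phi_n)\to\phi$ derivable.
   Formalization: Read literally, completeness fails: ⊟¬¬p→⊟p is valid but not derivable. So in the two axioms ⊟(φ1∧¬φ2)→(⊟¬φ1→⊟¬φ2), and likewise for ⊟⁻¹, ¬φi may also be written χ when φi is ¬χ; all literal instances are kept. *)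

theory Defs
  imports Main
begin

text \<open>The propositional variables of the two sorts are the elements of the types
  \<open>'p\<close> and \<open>'q\<close>; being types, they are nonempty and disjoint, and of arbitrary cardinality.
  \<open>Win\<close> is the window modality, taking formulas of the first sort to the second; \<open>WinInv\<close> is its inverse.\<close>

datatype ('p, 'q) fm1 =
    Atom1 'p
  | Neg1 "('p, 'q) fm1"
  | And1 "('p, 'q) fm1" "('p, 'q) fm1"
  | WinInv "('p, 'q) fm2"
and ('p, 'q) fm2 =
    Atom2 'q
  | Neg2 "('p, 'q) fm2"
  | And2 "('p, 'q) fm2" "('p, 'q) fm2"
  | Win "('p, 'q) fm1"

abbreviation Imp1 :: "('p, 'q) fm1 \<Rightarrow> ('p, 'q) fm1 \<Rightarrow> ('p, 'q) fm1" where
  "Imp1 \<phi> \<psi> \<equiv> Neg1 (And1 \<phi> (Neg1 \<psi>))"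

abbreviation Imp2 :: "('p, 'q) fm2 \<Rightarrow> ('p, 'q) fm2 \<Rightarrow> ('p, 'q) fm2" where
  "Imp2 \<phi> \<psi> \<equiv> Neg2 (And2 \<phi> (Neg2 \<psi>))"

record 'w frame =
  W1 :: "'w set"
  W2 :: "'w set"
  rel :: "('w \<times> 'w) set"
  rel_inv :: "('w \<times> 'w) set"

record ('w, 'p, 'q) model = "'w frame" +
  val1 :: "'p \<Rightarrow> 'w set"
  val2 :: "'q \<Rightarrow> 'w set"

definition SF2 :: "('w, 'm) frame_scheme set" where
  "SF2 = {F. W1 F \<noteq> {} \<and> W2 F \<noteq> {} \<and> W1 F \<inter> W2 F = {} \<and>
             rel F \<subseteq> W2 F \<times> W1 F \<and> rel_inv F = (rel F)\<inverse>}"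

definition SF2_models :: "('w, 'p, 'q) model set" where
  "SF2_models = {M. M \<in> SF2 \<and> (\<forall>p. val1 M p \<subseteq> W1 M) \<and> (\<forall>q. val2 M q \<subseteq> W2 M)}"

primrec sat1 :: "('w, 'p, 'q) model \<Rightarrow> 'w \<Rightarrow> ('p, 'q) fm1 \<Rightarrow> bool"
  and sat2 :: "('w, 'p, 'q) model \<Rightarrow> 'w \<Rightarrow> ('p, 'q) fm2 \<Rightarrow> bool" where
  "sat1 M w (Atom1 p) \<longleftrightarrow> w \<in> val1 M p"
| "sat1 M w (Neg1 \<phi>) \<longleftrightarrow> \<not> sat1 M w \<phi>"
| "sat1 M w (And1 \<phi> \<psi>) \<longleftrightarrow> sat1 M w \<phi> \<and> sat1 M w \<psi>"
| "sat1 M w (WinInv \<psi>) \<longleftrightarrow> (\<forall>w'\<in>W2 M. sat2 M w' \<psi> \<longrightarrow> (w, w') \<in> rel_inv M)"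
| "sat2 M w (Atom2 q) \<longleftrightarrow> w \<in> val2 M q"
| "sat2 M w (Neg2 \<phi>) \<longleftrightarrow> \<not> sat2 M w \<phi>"
| "sat2 M w (And2 \<phi> \<psi>) \<longleftrightarrow> sat2 M w \<phi> \<and> sat2 M w \<psi>"
| "sat2 M w (Win \<phi>) \<longleftrightarrow> (\<forall>w'\<in>W1 M. sat1 M w' \<phi> \<longrightarrow> (w, w') \<in> rel M)"

text \<open>Quantification over all models cannot range over all types inside a formula, so local
  consequence is relative to a type \<open>'w\<close> whose subsets serve as the sets of worlds.\<close>

definition entails1 :: "'w itself \<Rightarrow> ('p, 'q) fm1 set \<Rightarrow> ('p, 'q) fm1 \<Rightarrow> bool" where
  "entails1 _ \<Phi> \<phi> \<longleftrightarrow>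
     (\<forall>M \<in> (SF2_models :: ('w, 'p, 'q) model set). \<forall>w \<in> W1 M.
        (\<forall>\<chi>\<in>\<Phi>. sat1 M w \<chi>) \<longrightarrow> sat1 M w \<phi>)"

definition entails2 :: "'w itself \<Rightarrow> ('p, 'q) fm2 set \<Rightarrow> ('p, 'q) fm2 \<Rightarrow> bool" where
  "entails2 _ \<Phi> \<phi> \<longleftrightarrow>
     (\<forall>M \<in> (SF2_models :: ('w, 'p, 'q) model set). \<forall>w \<in> W2 M.
        (\<forall>\<chi>\<in>\<Phi>. sat2 M w \<chi>) \<longrightarrow> sat2 M w \<phi>)"

text \<open>Tautologies: \<open>h\<close> assigns truth values to the propositionally atomic formulas, namely the
  propositional variables and the formulas with a modality at the root.\<close>

fun peval1 :: "(('p, 'q) fm1 \<Rightarrow> bool) \<Rightarrow> ('p, 'q) fm1 \<Rightarrow> bool" where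
  "peval1 h (Atom1 p) \<longleftrightarrow> h (Atom1 p)"
| "peval1 h (Neg1 \<phi>) \<longleftrightarrow> \<not> peval1 h \<phi>"
| "peval1 h (And1 \<phi> \<psi>) \<longleftrightarrow> peval1 h \<phi> \<and> peval1 h \<psi>"
| "peval1 h (WinInv \<psi>) \<longleftrightarrow> h (WinInv \<psi>)"

fun peval2 :: "(('p, 'q) fm2 \<Rightarrow> bool) \<Rightarrow> ('p, 'q) fm2 \<Rightarrow> bool" where
  "peval2 h (Atom2 q) \<longleftrightarrow> h (Atom2 q)"
| "peval2 h (Neg2 \<phi>) \<longleftrightarrow> \<not> peval2 h \<phi>"
| "peval2 h (And2 \<phi> \<psi>) \<longleftrightarrow> peval2 h \<phi> \<and> peval2 h \<psi>"
| "peval2 h (Win \<phi>) \<longleftrightarrow> h (Win \<phi>)"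

definition taut1 :: "('p, 'q) fm1 \<Rightarrow> bool" where
  "taut1 \<phi> \<longleftrightarrow> (\<forall>h. peval1 h \<phi>)"

definition taut2 :: "('p, 'q) fm2 \<Rightarrow> bool" where
  "taut2 \<phi> \<longleftrightarrow> (\<forall>h. peval2 h \<phi>)"

text \<open>The axioms \<open>Win (\<phi>\<^sub>1 \<and> \<not>\<phi>\<^sub>2) \<rightarrow> (Win \<not>\<phi>\<^sub>1 \<rightarrow> Win \<not>\<phi>\<^sub>2)\<close> are read up to cancellation of double
  negations: the negation \<open>\<not>\<phi>\<close> of a metavariable may also be written \<open>\<chi>\<close> when \<open>\<phi>\<close> is \<open>\<not>\<chi>\<close>.
  With free syntax and only the instances where \<open>\<not>\<phi>\<^sub>i\<close> is literally a negation, no axiom or rule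
  relates \<open>Win p\<close> to \<open>Win (\<not>\<not>p)\<close> for a variable \<open>p\<close>, and completeness fails: interpreting
  \<open>Win p\<close> as false for all variables \<open>p\<close>, and everything else as usual, validates all those
  axioms and rules but not the valid formula \<open>Win (\<not>\<not>p) \<rightarrow> Win p\<close>.\<close>

definition opp1 :: "('p, 'q) fm1 \<Rightarrow> ('p, 'q) fm1 \<Rightarrow> bool" where
  "opp1 \<phi> \<chi> \<longleftrightarrow> \<chi> = Neg1 \<phi> \<or> \<phi> = Neg1 \<chi>"

definition opp2 :: "('p, 'q) fm2 \<Rightarrow> ('p, 'q) fm2 \<Rightarrow> bool" where
  "opp2 \<phi> \<chi> \<longleftrightarrow> \<chi> = Neg2 \<phi> \<or> \<phi> = Neg2 \<chi>"

inductive KF1 :: "('p, 'q) fm1 \<Rightarrow> bool" and KF2 :: "('p, 'q) fm2 \<Rightarrow> bool" where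
  taut1: "taut1 \<phi> \<Longrightarrow> KF1 \<phi>"
| taut2: "taut2 \<psi> \<Longrightarrow> KF2 \<psi>"
| K_Win: "opp1 \<phi>\<^sub>1 \<chi>\<^sub>1 \<Longrightarrow> opp1 \<phi>\<^sub>2 \<chi>\<^sub>2 \<Longrightarrow>
    KF2 (Imp2 (Win (And1 \<phi>\<^sub>1 \<chi>\<^sub>2)) (Imp2 (Win \<chi>\<^sub>1) (Win \<chi>\<^sub>2)))"
| K_WinInv: "opp2 \<psi>\<^sub>1 \<chi>\<^sub>1 \<Longrightarrow> opp2 \<psi>\<^sub>2 \<chi>\<^sub>2 \<Longrightarrow>
    KF1 (Imp1 (WinInv (And2 \<psi>\<^sub>1 \<chi>\<^sub>2)) (Imp1 (WinInv \<chi>\<^sub>1) (WinInv \<chi>\<^sub>2)))"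
| B1: "KF1 (Imp1 \<phi> (WinInv (Win \<phi>)))"
| B2: "KF2 (Imp2 \<psi> (Win (WinInv \<psi>)))"
| MP1: "KF1 \<phi> \<Longrightarrow> KF1 (Imp1 \<phi> \<phi>') \<Longrightarrow> KF1 \<phi>'"
| MP2: "KF2 \<psi> \<Longrightarrow> KF2 (Imp2 \<psi> \<psi>') \<Longrightarrow> KF2 \<psi>'"
| UG_Win: "KF1 (Neg1 \<phi>) \<Longrightarrow> KF2 (Win \<phi>)"
| UG_WinInv: "KF2 (Neg2 \<psi>) \<Longrightarrow> KF1 (WinInv \<psi>)"

text \<open>\<open>conj_imp1 [\<phi>\<^sub>1, \<dots>, \<phi>\<^sub>n] \<phi>\<close> is \<open>(\<phi>\<^sub>1 \<and> \<dots> \<and> \<phi>\<^sub>n) \<rightarrow> \<phi>\<close>, and \<open>\<phi>\<close> itself for \<open>n = 0\<close>.\<close>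

fun conjs1 :: "('p, 'q) fm1 \<Rightarrow> ('p, 'q) fm1 list \<Rightarrow> ('p, 'q) fm1" where
  "conjs1 \<phi> [] = \<phi>"
| "conjs1 \<phi> (\<psi> # \<Gamma>) = And1 \<phi> (conjs1 \<psi> \<Gamma>)"

fun conjs2 :: "('p, 'q) fm2 \<Rightarrow> ('p, 'q) fm2 list \<Rightarrow> ('p, 'q) fm2" where
  "conjs2 \<phi> [] = \<phi>"
| "conjs2 \<phi> (\<psi> # \<Gamma>) = And2 \<phi> (conjs2 \<psi> \<Gamma>)"

fun conj_imp1 :: "('p, 'q) fm1 list \<Rightarrow> ('p, 'q) fm1 \<Rightarrow> ('p, 'q) fm1" where
  "conj_imp1 [] \<phi> = \<phi>"
| "conj_imp1 (\<psi> # \<Gamma>) \<phi> = Imp1 (conjs1 \<psi> \<Gamma>) \<phi>"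

fun conj_imp2 :: "('p, 'q) fm2 list \<Rightarrow> ('p, 'q) fm2 \<Rightarrow> ('p, 'q) fm2" where
  "conj_imp2 [] \<phi> = \<phi>"
| "conj_imp2 (\<psi> # \<Gamma>) \<phi> = Imp2 (conjs2 \<psi> \<Gamma>) \<phi>"

definition proves1 :: "('p, 'q) fm1 set \<Rightarrow> ('p, 'q) fm1 \<Rightarrow> bool" where
  "proves1 \<Phi> \<phi> \<longleftrightarrow> (\<exists>\<Gamma>. set \<Gamma> \<subseteq> \<Phi> \<and> KF1 (conj_imp1 \<Gamma> \<phi>))"

definition proves2 :: "('p, 'q) fm2 set \<Rightarrow> ('p, 'q) fm2 \<Rightarrow> bool" where
  "proves2 \<Phi> \<phi> \<longleftrightarrow> (\<exists>\<Gamma>. set \<Gamma> \<subseteq> \<Phi> \<and> KF2 (conj_imp2 \<Gamma> \<phi>))"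

text \<open>A type of worlds that is large enough for completeness. Soundness is stated for models over
  every type, so that together with completeness over this one type provability coincides with
  consequence over all models.\<close>

type_synonym ('p, 'q) world = "('p, 'q) fm1 set + ('p, 'q) fm2 set"

end

theory Submission
  imports Defs
begin

text \<open>Completeness is by a canonical model whose worlds are the maximal consistent sets of the two
  sorts. A world \<open>w\<close> of the second sort is related to a world \<open>u\<close> of the first sort iff some \<open>\<phi> \<in> u\<close>
  has \<open>Win \<phi> \<in> w\<close>; the axioms \<open>\<phi> \<rightarrow> WinInv (Win \<phi>)\<close> and \<open>\<psi> \<rightarrow> Win (WinInv \<psi>)\<close> say that the
  converse relation has the same description with \<open>WinInv\<close>. If \<open>Win \<phi> \<notin> w\<close>, then \<open>\<phi>\<close> together with
  all \<open>\<not>\<alpha>\<close> such that \<open>Win \<alpha> \<in> w\<close> is consistent, which yields a world satisfying \<open>\<phi>\<close> that is not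
  related to \<open>w\<close>.\<close>

section \<open>Maximal consistent sets\<close>

text \<open>Both sorts are instances of the following abstract propositional logic. The connectives are
  known only through the family \<open>val\<close> of Boolean valuations, and \<open>ci \<Gamma> \<phi>\<close> stands for the implication
  from the conjunction of the list \<open>\<Gamma>\<close> to \<open>\<phi>\<close>.\<close>

locale prop_logic =
  fixes neg :: "'f \<Rightarrow> 'f" and conj :: "'f \<Rightarrow> 'f \<Rightarrow> 'f" and ci :: "'f list \<Rightarrow> 'f \<Rightarrow> 'f"
    and val :: "'v \<Rightarrow> 'f \<Rightarrow> bool" and T :: "'f \<Rightarrow> bool"
  assumes val_neg: "val h (neg \<phi>) \<longleftrightarrow> \<not> val h \<phi>"
    and val_conj: "val h (conj \<phi> \<psi>) \<longleftrightarrow> val h \<phi> \<and> val h \<psi>"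
    and val_ci: "val h (ci \<Gamma> \<phi>) \<longleftrightarrow> ((\<forall>\<gamma>\<in>set \<Gamma>. val h \<gamma>) \<longrightarrow> val h \<phi>)"
    and taut: "(\<And>h. val h \<phi>) \<Longrightarrow> T \<phi>"
    and mp: "T \<phi> \<Longrightarrow> T (neg (conj \<phi> (neg \<psi>))) \<Longrightarrow> T \<psi>"
begin

abbreviation imp :: "'f \<Rightarrow> 'f \<Rightarrow> 'f" where
  "imp \<phi> \<psi> \<equiv> neg (conj \<phi> (neg \<psi>))"

lemmas val_simps = val_neg val_conj val_ci

definition proves :: "'f set \<Rightarrow> 'f \<Rightarrow> bool" where
  "proves \<Phi> \<phi> \<longleftrightarrow> (\<exists>\<Gamma>. set \<Gamma> \<subseteq> \<Phi> \<and> T (ci \<Gamma> \<phi>))"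

text \<open>Consistency is implicit: by closure an inconsistent set would contain both a formula and
  its negation, against the second clause.\<close>

definition mcs :: "'f set \<Rightarrow> bool" where
  "mcs w \<longleftrightarrow> (\<forall>\<phi>. proves w \<phi> \<longrightarrow> \<phi> \<in> w) \<and> (\<forall>\<phi>. neg \<phi> \<in> w \<longleftrightarrow> \<phi> \<notin> w)"

lemma conseq: "T \<phi> \<Longrightarrow> (\<And>h. val h \<phi> \<Longrightarrow> val h \<psi>) \<Longrightarrow> T \<psi>"
  by (rule mp, assumption, rule taut) (auto simp: val_simps)

lemma conseq2:
  assumes "T \<phi>" "T \<psi>" "\<And>h. val h \<phi> \<Longrightarrow> val h \<psi> \<Longrightarrow> val h \<chi>"
  shows "T \<chi>"
proof (rule mp[OF assms(2)])
  show "T (imp \<psi> \<chi>)" using assms(1) by (rule conseq) (auto simp: val_simps assms(3))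
qed

lemma proves_cut:
  assumes "proves (insert \<psi> \<Phi>) \<phi>" "proves \<Phi> \<psi>"
  shows "proves \<Phi> \<phi>"
proof -
  obtain \<Gamma> \<Delta> where \<Gamma>: "set \<Gamma> \<subseteq> insert \<psi> \<Phi>" "T (ci \<Gamma> \<phi>)" and \<Delta>: "set \<Delta> \<subseteq> \<Phi>" "T (ci \<Delta> \<psi>)"
    using assms unfolding proves_def by blast
  have "T (ci (removeAll \<psi> \<Gamma> @ \<Delta>) \<phi>)"
    using \<Gamma>(2) \<Delta>(2) by (rule conseq2) (auto simp: val_simps)
  moreover have "set (removeAll \<psi> \<Gamma> @ \<Delta>) \<subseteq> \<Phi>"
    using \<Gamma>(1) \<Delta>(1) by auto
  ultimately show ?thesis unfolding proves_def by blast
qed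

text \<open>Excluded middle: every valuation satisfies \<open>\<psi>\<close> or
  \<open>neg \<psi>\<close>, so one of the two lists loses only a true formula by the
  removal.\<close>

lemma proves_neg_cases:
  assumes "proves (insert \<psi> \<Phi>) \<phi>" "proves (insert (neg \<psi>) \<Phi>) \<phi>"
  shows "proves \<Phi> \<phi>"
proof -
  obtain \<Gamma> \<Delta> where \<Gamma>: "set \<Gamma> \<subseteq> insert \<psi> \<Phi>" "T (ci \<Gamma> \<phi>)"
    and \<Delta>: "set \<Delta> \<subseteq> insert (neg \<psi>) \<Phi>" "T (ci \<Delta> \<phi>)"
    using assms unfolding proves_def by blast
  have "T (ci (removeAll \<psi> \<Gamma> @ removeAll (neg \<psi>) \<Delta>) \<phi>)"
    using \<Gamma>(2) \<Delta>(2)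
  proof (rule conseq2)
    fix h
    assume "val h (ci \<Gamma> \<phi>)" "val h (ci \<Delta> \<phi>)"
    then show "val h (ci (removeAll \<psi> \<Gamma> @ removeAll (neg \<psi>) \<Delta>) \<phi>)"
      unfolding val_ci set_append set_removeAll by (metis DiffI UnI1 UnI2 singletonD val_neg)
  qed
  moreover have "set (removeAll \<psi> \<Gamma> @ removeAll (neg \<psi>) \<Delta>) \<subseteq> \<Phi>"
    using \<Gamma>(1) \<Delta>(1) by auto
  ultimately show ?thesis unfolding proves_def by blast
qed

lemma proves_mem: "\<phi> \<in> \<Phi> \<Longrightarrow> proves \<Phi> \<phi>"
  unfolding proves_def by (rule exI[of _ "[\<phi>]"]) (auto intro: taut simp: val_simps)

lemma proves_contradiction:
  assumes "\<psi> \<in> \<Phi>" "neg \<psi> \<in> \<Phi>"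
  shows "proves \<Phi> \<phi>"
  unfolding proves_def using assms
  by (intro exI[of _ "[\<psi>, neg \<psi>]"]) (auto intro: taut simp: val_simps)

text \<open>A derivation uses finitely many premises, and these already lie in one member of the
  chain.\<close>

lemma proves_Union_chain:
  assumes "subset.chain A C" "C \<noteq> {}" "proves (\<Union>C) \<phi>"
  obtains \<Phi> where "\<Phi> \<in> C" "proves \<Phi> \<phi>"
proof -
  obtain \<Gamma> where \<Gamma>: "set \<Gamma> \<subseteq> \<Union>C" "T (ci \<Gamma> \<phi>)"
    using assms(3) unfolding proves_def by blast
  obtain \<Phi> where "\<Phi> \<in> C" "set \<Gamma> \<subseteq> \<Phi>"
    using finite_subset_Union_chain[OF finite_set \<Gamma>(1) assms(2,1)] .
  with \<Gamma>(2) show thesis by (intro that) (auto simp: proves_def)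
qed

text \<open>Zorn's lemma is applied to the supersets of \<open>\<Phi>\<close> that do not prove
  \<open>\<phi>\<close>. Not proving \<open>\<phi>\<close> includes consistency, since a
  contradiction proves everything.\<close>

lemma lindenbaum:
  assumes "\<not> proves \<Phi> \<phi>"
  obtains w where "mcs w" "\<Phi> \<subseteq> w" "\<phi> \<notin> w"
proof -
  define A where "A = {w. \<Phi> \<subseteq> w \<and> \<not> proves w \<phi>}"
  have "\<exists>w\<in>A. \<forall>X\<in>A. w \<subseteq> X \<longrightarrow> X = w"
  proof (rule subset_Zorn_nonempty)
    show "A \<noteq> {}" using assms by (auto simp: A_def)
    fix C assume C: "C \<noteq> {}" "subset.chain A C"
    have "C \<subseteq> A" using C(2) by (simp add: subset.chain_def)
    then show "\<Union>C \<in> A"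
      using C by (auto simp: A_def elim: proves_Union_chain)
  qed
  then obtain w where w: "\<Phi> \<subseteq> w" "\<not> proves w \<phi>"
    and w_max: "\<And>X. X \<in> A \<Longrightarrow> w \<subseteq> X \<Longrightarrow> X = w"
    by (auto simp: A_def)
  have max: "proves (insert \<psi> w) \<phi>" if "\<psi> \<notin> w" for \<psi>
    using that w(1) w_max[of "insert \<psi> w"] by (auto simp: A_def)
  have "mcs w" unfolding mcs_def
  \<comment> \<open>Failure of any clause would make \<open>w\<close> prove \<open>\<phi>\<close>:
    by cut, by contradiction, or by cases on \<open>\<psi>\<close>.\<close>
  proof (intro conjI allI impI iffI)
    show "\<psi> \<in> w" if "proves w \<psi>" for \<psi>
      using that max w(2) proves_cut by blast
    show "\<psi> \<notin> w" if "neg \<psi> \<in> w" for \<psi>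
      using that w(2) proves_contradiction by blast
    show "neg \<psi> \<in> w" if "\<psi> \<notin> w" for \<psi>
      using that max w(2) proves_neg_cases by blast
  qed
  moreover have "\<phi> \<notin> w" using w(2) proves_mem by blast
  ultimately show thesis using w(1) that by blast
qed

lemma mcs_neg: "mcs w \<Longrightarrow> neg \<phi> \<in> w \<longleftrightarrow> \<phi> \<notin> w"
  by (simp add: mcs_def)

lemma mcs_closed:
  assumes "mcs w" "set \<Gamma> \<subseteq> w" "T \<psi>" "\<And>h. val h \<psi> \<Longrightarrow> \<forall>\<gamma>\<in>set \<Gamma>. val h \<gamma> \<Longrightarrow> val h \<phi>"
  shows "\<phi> \<in> w"
proof -
  have "T (ci \<Gamma> \<phi>)" using assms(3) by (rule conseq) (auto simp: val_simps assms(4))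
  with assms(1,2) show ?thesis unfolding mcs_def proves_def by blast
qed

lemma mcs_theorem: "mcs w \<Longrightarrow> T \<phi> \<Longrightarrow> \<phi> \<in> w"
  by (rule mcs_closed[of w "[]"]) auto

lemma mcs_mp: "mcs w \<Longrightarrow> imp \<phi> \<psi> \<in> w \<Longrightarrow> \<phi> \<in> w \<Longrightarrow> \<psi> \<in> w"
  \<comment> \<open>The tautology \<open>imp \<phi> \<phi>\<close> serves as the theorem that
    \<open>mcs_closed\<close> asks for.\<close>
  by (rule mcs_closed[of w "[imp \<phi> \<psi>, \<phi>]" "imp \<phi> \<phi>"]) (auto intro: taut simp: val_simps)

lemma mcs_conj:
  assumes "mcs w"
  shows "conj \<phi> \<psi> \<in> w \<longleftrightarrow> \<phi> \<in> w \<and> \<psi> \<in> w"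
proof -
  have "T (imp \<phi> \<phi>)" by (rule taut) (simp add: val_simps)
  note closed = mcs_closed[OF assms _ this]
  have "conj \<phi> \<psi> \<in> w \<Longrightarrow> \<phi> \<in> w" "conj \<phi> \<psi> \<in> w \<Longrightarrow> \<psi> \<in> w"
    using closed[of "[conj \<phi> \<psi>]"] by (simp_all add: val_conj)
  moreover have "\<phi> \<in> w \<Longrightarrow> \<psi> \<in> w \<Longrightarrow> conj \<phi> \<psi> \<in> w"
    using closed[of "[\<phi>, \<psi>]"] by (simp add: val_conj)
  ultimately show ?thesis by blast
qed

end

section \<open>Worlds unrelated to a given world\<close>

text \<open>A single modality between two sorts, so that \<open>WinInv\<close> is the same situation
  with the sorts exchanged.\<close>

locale window_logic =
  A: prop_logic neg\<^sub>1 conj\<^sub>1 ci\<^sub>1 val\<^sub>1 T\<^sub>1 + B: prop_logic neg\<^sub>2 conj\<^sub>2 ci\<^sub>2 val\<^sub>2 T\<^sub>2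
  for neg\<^sub>1 :: "'f \<Rightarrow> 'f" and conj\<^sub>1 ci\<^sub>1 val\<^sub>1 T\<^sub>1
    and neg\<^sub>2 :: "'g \<Rightarrow> 'g" and conj\<^sub>2 ci\<^sub>2 val\<^sub>2 T\<^sub>2 +
  fixes W :: "'f \<Rightarrow> 'g"
  assumes K: "T\<^sub>2 (B.imp (W (conj\<^sub>1 (neg\<^sub>1 \<phi>) \<psi>)) (B.imp (W \<phi>) (W \<psi>)))"
    and UG: "T\<^sub>1 (neg\<^sub>1 \<phi>) \<Longrightarrow> T\<^sub>2 (W \<phi>)"
begin

text \<open>The formulas \<open>\<alpha>\<close> with \<open>W \<alpha> \<in> w\<close> form an
  ideal: \<open>UG\<close> admits the refutable ones, and \<open>K\<close> admits
  \<open>\<psi>\<close> once \<open>\<phi>\<close> and the part of \<open>\<psi>\<close> outside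
  \<open>\<phi>\<close> are in. Hence a formula implying a finite disjunction of members is a
  member.\<close>

lemma window_of_refutable:
  assumes "B.mcs w" "T\<^sub>1 (ci\<^sub>1 (map neg\<^sub>1 \<Gamma>) (neg\<^sub>1 \<phi>))" "\<forall>\<alpha>\<in>set \<Gamma>. W \<alpha> \<in> w"
  shows "W \<phi> \<in> w"
  using assms(2,3)
proof (induction \<Gamma> arbitrary: \<phi>)
  case Nil
  from Nil(1) have "T\<^sub>1 (neg\<^sub>1 \<phi>)" by (rule A.conseq) (simp add: A.val_simps)
  with assms(1) show ?case using UG B.mcs_theorem by blast
next
  case (Cons \<alpha> \<Gamma>)
  \<comment> \<open>The premise \<open>neg \<alpha>\<close> moves into the conclusion: the induction
    hypothesis is used for the part of \<open>\<phi>\<close> outside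
    \<open>\<alpha>\<close>.\<close>
  from Cons.prems(1) have "T\<^sub>1 (ci\<^sub>1 (map neg\<^sub>1 \<Gamma>) (neg\<^sub>1 (conj\<^sub>1 (neg\<^sub>1 \<alpha>) \<phi>)))"
    by (rule A.conseq) (auto simp: A.val_simps)
  with Cons have "W (conj\<^sub>1 (neg\<^sub>1 \<alpha>) \<phi>) \<in> w" "W \<alpha> \<in> w" by auto
  moreover have "B.imp (W (conj\<^sub>1 (neg\<^sub>1 \<alpha>) \<phi>)) (B.imp (W \<alpha>) (W \<phi>)) \<in> w"
    using assms(1) K by (rule B.mcs_theorem)
  ultimately show ?case using assms(1) B.mcs_mp by blast
qed

lemma unrelated_world:
  assumes "B.mcs w" "W \<phi> \<notin> w"
  obtains u where "A.mcs u" "\<phi> \<in> u" "\<forall>\<alpha>. W \<alpha> \<in> w \<longrightarrow> \<alpha> \<notin> u"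
proof -
  have "\<not> A.proves (neg\<^sub>1 ` {\<alpha>. W \<alpha> \<in> w}) (neg\<^sub>1 \<phi>)"
  proof
    assume "A.proves (neg\<^sub>1 ` {\<alpha>. W \<alpha> \<in> w}) (neg\<^sub>1 \<phi>)"
    then obtain \<Delta> where \<Delta>: "set \<Delta> \<subseteq> neg\<^sub>1 ` {\<alpha>. W \<alpha> \<in> w}" "T\<^sub>1 (ci\<^sub>1 \<Delta> (neg\<^sub>1 \<phi>))"
      unfolding A.proves_def by blast
    \<comment> \<open>A list over an image is the map of a list of preimages, the shape that
      \<open>window_of_refutable\<close> expects.\<close>
    then have "\<Delta> \<in> map neg\<^sub>1 ` lists {\<alpha>. W \<alpha> \<in> w}"
      by (metis in_lists_conv_set lists_image subsetD)
    with \<Delta>(2) assms window_of_refutable show False by blast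
  qed
  then obtain u where "A.mcs u" "neg\<^sub>1 ` {\<alpha>. W \<alpha> \<in> w} \<subseteq> u" "neg\<^sub>1 \<phi> \<notin> u"
    by (rule A.lindenbaum)
  then show thesis using A.mcs_neg by (intro that) auto
qed

end

section \<open>The two sorts of KF as instances of the abstract logics\<close>

lemma peval1_conjs1: "peval1 h (conjs1 \<psi> \<Gamma>) \<longleftrightarrow> (\<forall>\<gamma>\<in>set (\<psi> # \<Gamma>). peval1 h \<gamma>)"
  by (induction \<Gamma> arbitrary: \<psi>) auto

lemma peval2_conjs2: "peval2 h (conjs2 \<psi> \<Gamma>) \<longleftrightarrow> (\<forall>\<gamma>\<in>set (\<psi> # \<Gamma>). peval2 h \<gamma>)"
  by (induction \<Gamma> arbitrary: \<psi>) auto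

lemma peval1_conj_imp1:
  "peval1 h (conj_imp1 \<Gamma> \<phi>) \<longleftrightarrow> ((\<forall>\<gamma>\<in>set \<Gamma>. peval1 h \<gamma>) \<longrightarrow> peval1 h \<phi>)"
  by (cases \<Gamma>) (auto simp: peval1_conjs1)

lemma peval2_conj_imp2:
  "peval2 h (conj_imp2 \<Gamma> \<phi>) \<longleftrightarrow> ((\<forall>\<gamma>\<in>set \<Gamma>. peval2 h \<gamma>) \<longrightarrow> peval2 h \<phi>)"
  by (cases \<Gamma>) (auto simp: peval2_conjs2)

interpretation L1: prop_logic Neg1 And1 conj_imp1 peval1 KF1
proof
  show "KF1 \<phi>" if "\<And>h. peval1 h \<phi>" for \<phi>
    using that by (intro KF1_KF2.taut1) (simp add: taut1_def)
qed (fact KF1_KF2.MP1 | simp add: peval1_conj_imp1)+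

interpretation L2: prop_logic Neg2 And2 conj_imp2 peval2 KF2
proof
  show "KF2 \<phi>" if "\<And>h. peval2 h \<phi>" for \<phi>
    using that by (intro KF1_KF2.taut2) (simp add: taut2_def)
qed (fact KF1_KF2.MP2 | simp add: peval2_conj_imp2)+

interpretation Win: window_logic
  Neg1 And1 conj_imp1 peval1 KF1 Neg2 And2 conj_imp2 peval2 KF2 Win
proof
  fix \<phi> \<psi> :: "('p, 'q) fm1"
  \<comment> \<open>Cancellation of double negations enters here: \<open>\<phi>\<close> and
    \<open>\<psi>\<close> act as the negations of \<open>Neg1 \<phi>\<close> and
    \<open>Neg1 \<psi>\<close>.\<close>
  have "opp1 (Neg1 \<phi>) \<phi>" "opp1 (Neg1 \<psi>) \<psi>" by (simp_all add: opp1_def)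
  then show "KF2 (L2.imp (Win (And1 (Neg1 \<phi>) \<psi>)) (L2.imp (Win \<phi>) (Win \<psi>)))"
    by (rule KF1_KF2.K_Win)
qed (rule KF1_KF2.UG_Win)

interpretation WinInv: window_logic
  Neg2 And2 conj_imp2 peval2 KF2 Neg1 And1 conj_imp1 peval1 KF1 WinInv
proof
  fix \<phi> \<psi> :: "('p, 'q) fm2"
  have "opp2 (Neg2 \<phi>) \<phi>" "opp2 (Neg2 \<psi>) \<psi>" by (simp_all add: opp2_def)
  then show "KF1 (L1.imp (WinInv (And2 (Neg2 \<phi>) \<psi>)) (L1.imp (WinInv \<phi>) (WinInv \<psi>)))"
    by (rule KF1_KF2.K_WinInv)
qed (rule KF1_KF2.UG_WinInv)

section \<open>Soundness\<close>

text \<open>Satisfaction at a world is itself a Boolean valuation, so tautologies and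
  \<open>conj_imp1\<close> need no separate semantic argument.\<close>

lemma peval1_sat1: "peval1 (sat1 M w) \<phi> \<longleftrightarrow> sat1 M w \<phi>"
  by (induction "sat1 M w" \<phi> rule: peval1.induct) auto

lemma peval2_sat2: "peval2 (sat2 M w) \<phi> \<longleftrightarrow> sat2 M w \<phi>"
  by (induction "sat2 M w" \<phi> rule: peval2.induct) auto

lemma sat1_conj_imp1:
  "sat1 M w (conj_imp1 \<Gamma> \<phi>) \<longleftrightarrow> ((\<forall>\<gamma>\<in>set \<Gamma>. sat1 M w \<gamma>) \<longrightarrow> sat1 M w \<phi>)"
  using peval1_conj_imp1[of "sat1 M w"] by (simp add: peval1_sat1)

lemma sat2_conj_imp2:
  "sat2 M w (conj_imp2 \<Gamma> \<phi>) \<longleftrightarrow> ((\<forall>\<gamma>\<in>set \<Gamma>. sat2 M w \<gamma>) \<longrightarrow> sat2 M w \<phi>)"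
  using peval2_conj_imp2[of "sat2 M w"] by (simp add: peval2_sat2)

lemma opp1_sat1: "opp1 \<phi> \<chi> \<Longrightarrow> sat1 M w \<chi> \<longleftrightarrow> \<not> sat1 M w \<phi>"
  by (auto simp: opp1_def)

lemma opp2_sat2: "opp2 \<phi> \<chi> \<Longrightarrow> sat2 M w \<chi> \<longleftrightarrow> \<not> sat2 M w \<phi>"
  by (auto simp: opp2_def)

lemma KF_sound:
  assumes "M \<in> SF2_models"
  shows KF1_sound: "KF1 \<phi> \<Longrightarrow> w \<in> W1 M \<Longrightarrow> sat1 M w \<phi>"
    and KF2_sound: "KF2 \<psi> \<Longrightarrow> w \<in> W2 M \<Longrightarrow> sat2 M w \<psi>"
proof -
  have inv: "rel_inv M = (rel M)\<inverse>"
    using assms by (simp add: SF2_models_def SF2_def)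
  \<comment> \<open>Both sorts are treated in one induction, because the generalization rules cross
    between them.\<close>
  have "(KF1 \<phi> \<longrightarrow> (\<forall>w\<in>W1 M. sat1 M w \<phi>)) \<and> (KF2 \<psi> \<longrightarrow> (\<forall>w\<in>W2 M. sat2 M w \<psi>))"
  proof (induction rule: KF1_KF2.induct)
    case (taut1 \<phi>)
    then show ?case by (metis taut1_def peval1_sat1)
  next
    case (taut2 \<psi>)
    then show ?case by (metis taut2_def peval2_sat2)
  next
    case (K_Win \<phi>\<^sub>1 \<chi>\<^sub>1 \<phi>\<^sub>2 \<chi>\<^sub>2)
    \<comment> \<open>A world satisfying \<open>\<chi>\<^sub>2\<close> satisfies
      \<open>\<phi>\<^sub>1\<close> or \<open>\<chi>\<^sub>1\<close>; one of the two windows then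
      relates it.\<close>
    then show ?case using opp1_sat1[of \<phi>\<^sub>1 \<chi>\<^sub>1 M] by auto
  next
    case (K_WinInv \<psi>\<^sub>1 \<chi>\<^sub>1 \<psi>\<^sub>2 \<chi>\<^sub>2)
    then show ?case using opp2_sat2[of \<psi>\<^sub>1 \<chi>\<^sub>1 M] by auto
  qed (simp add: inv; blast)+
  then show "KF1 \<phi> \<Longrightarrow> w \<in> W1 M \<Longrightarrow> sat1 M w \<phi>" "KF2 \<psi> \<Longrightarrow> w \<in> W2 M \<Longrightarrow> sat2 M w \<psi>"
    by blast+
qed

lemma proves1_sound: "proves1 \<Phi> \<phi> \<Longrightarrow> entails1 TYPE('w) \<Phi> \<phi>"
  unfolding proves1_def entails1_def by (meson KF1_sound sat1_conj_imp1 subsetD)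

lemma proves2_sound: "proves2 \<Phi> \<phi> \<Longrightarrow> entails2 TYPE('w) \<Phi> \<phi>"
  unfolding proves2_def entails2_def by (meson KF2_sound sat2_conj_imp2 subsetD)

text \<open>By soundness, a concrete model gives the consistency of both sorts, and thus nonempty
  sets of canonical worlds.\<close>

definition two_point_model :: "(bool, 'p, 'q) model" where
  "two_point_model = \<lparr>W1 = {True}, W2 = {False}, rel = {}, rel_inv = {},
     val1 = \<lambda>_. {}, val2 = \<lambda>_. {}\<rparr>"

lemma two_point_model: "two_point_model \<in> SF2_models"
  by (auto simp: two_point_model_def SF2_models_def SF2_def)

lemma mcs1_exists: "\<exists>u. L1.mcs (u :: ('p, 'q) fm1 set)"
proof -
  \<comment> \<open>\<open>undefined\<close> names some variable; the resulting contradiction fails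
    in every model.\<close>
  let ?\<phi> = "And1 (Atom1 undefined) (Neg1 (Atom1 undefined)) :: ('p, 'q) fm1"
  have "\<not> sat1 two_point_model True ?\<phi>" by simp
  then have "\<not> entails1 TYPE(bool) {} ?\<phi>"
    using two_point_model by (force simp: entails1_def two_point_model_def)
  then have "\<not> L1.proves {} ?\<phi>"
    using proves1_sound unfolding proves1_def L1.proves_def by blast
  then show ?thesis by (blast elim: L1.lindenbaum)
qed

lemma mcs2_exists: "\<exists>w. L2.mcs (w :: ('p, 'q) fm2 set)"
proof -
  let ?\<phi> = "And2 (Atom2 undefined) (Neg2 (Atom2 undefined)) :: ('p, 'q) fm2"
  have "\<not> sat2 two_point_model False ?\<phi>" by simp
  then have "\<not> entails2 TYPE(bool) {} ?\<phi>"
    using two_point_model by (force simp: entails2_def two_point_model_def)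
  then have "\<not> L2.proves {} ?\<phi>"
    using proves2_sound unfolding proves2_def L2.proves_def by blast
  then show ?thesis by (blast elim: L2.lindenbaum)
qed

section \<open>The canonical model\<close>

text \<open>The least relation for which \<open>Win \<phi> \<in> w\<close> relates \<open>w\<close>
  to every maximal consistent set containing \<open>\<phi>\<close>; hence an existential condition,
  unlike the universal one for a box.\<close>

definition canonical_rel :: "(('p, 'q) world \<times> ('p, 'q) world) set" where
  "canonical_rel = {(Inr w, Inl u) | w u. L2.mcs w \<and> L1.mcs u \<and> (\<exists>\<phi>\<in>u. Win \<phi> \<in> w)}"

definition canonical_model :: "(('p, 'q) world, 'p, 'q) model" where
  "canonical_model = \<lparr>W1 = Inl ` {u. L1.mcs u}, W2 = Inr ` {w. L2.mcs w},
     rel = canonical_rel, rel_inv = canonical_rel\<inverse>,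
     val1 = \<lambda>p. Inl ` {u. L1.mcs u \<and> Atom1 p \<in> u},
     val2 = \<lambda>q. Inr ` {w. L2.mcs w \<and> Atom2 q \<in> w}\<rparr>"

lemma canonical_model: "canonical_model \<in> SF2_models"
  using mcs1_exists mcs2_exists
  by (auto simp: canonical_model_def SF2_models_def SF2_def canonical_rel_def)

text \<open>A witness \<open>\<phi>\<close> on the left yields the witness \<open>Win \<phi>\<close>
  on the right by \<open>B1\<close>; conversely \<open>\<psi>\<close> yields
  \<open>WinInv \<psi>\<close> by \<open>B2\<close>.\<close>

lemma related_iff:
  assumes "L1.mcs u" "L2.mcs w"
  shows "(\<exists>\<phi>\<in>u. Win \<phi> \<in> w) \<longleftrightarrow> (\<exists>\<psi>\<in>w. WinInv \<psi> \<in> u)"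
proof
  assume "\<exists>\<phi>\<in>u. Win \<phi> \<in> w"
  then obtain \<phi> where "\<phi> \<in> u" "Win \<phi> \<in> w" by blast
  moreover have "Imp1 \<phi> (WinInv (Win \<phi>)) \<in> u"
    using assms(1) KF1_KF2.B1 by (rule L1.mcs_theorem)
  ultimately show "\<exists>\<psi>\<in>w. WinInv \<psi> \<in> u" using assms(1) L1.mcs_mp by blast
next
  assume "\<exists>\<psi>\<in>w. WinInv \<psi> \<in> u"
  then obtain \<psi> where "\<psi> \<in> w" "WinInv \<psi> \<in> u" by blast
  moreover have "Imp2 \<psi> (Win (WinInv \<psi>)) \<in> w"
    using assms(2) KF1_KF2.B2 by (rule L2.mcs_theorem)
  ultimately show "\<exists>\<phi>\<in>u. Win \<phi> \<in> w" using assms(2) L2.mcs_mp by blast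
qed

lemma canonical_rel_iff:
  assumes "L1.mcs u" "L2.mcs w"
  shows "(Inr w, Inl u) \<in> canonical_rel \<longleftrightarrow> (\<exists>\<phi>\<in>u. Win \<phi> \<in> w)"
    and "(Inr w, Inl u) \<in> canonical_rel \<longleftrightarrow> (\<exists>\<psi>\<in>w. WinInv \<psi> \<in> u)"
  using assms related_iff[OF assms] by (auto simp: canonical_rel_def)

lemma Win_in_mcs_iff:
  assumes "L2.mcs w"
  shows "Win \<phi> \<in> w \<longleftrightarrow> (\<forall>u. L1.mcs u \<longrightarrow> \<phi> \<in> u \<longrightarrow> (Inr w, Inl u) \<in> canonical_rel)"
proof
  assume "Win \<phi> \<in> w"
  then show "\<forall>u. L1.mcs u \<longrightarrow> \<phi> \<in> u \<longrightarrow> (Inr w, Inl u) \<in> canonical_rel"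
    using assms canonical_rel_iff(1) by blast
next
  assume related: "\<forall>u. L1.mcs u \<longrightarrow> \<phi> \<in> u \<longrightarrow> (Inr w, Inl u) \<in> canonical_rel"
  show "Win \<phi> \<in> w"
  proof (rule ccontr)
    assume "Win \<phi> \<notin> w"
    with assms obtain u where "L1.mcs u" "\<phi> \<in> u" "\<forall>\<alpha>. Win \<alpha> \<in> w \<longrightarrow> \<alpha> \<notin> u"
      by (rule Win.unrelated_world)
    \<comment> \<open>Since \<open>\<phi> \<in> u\<close>, the world \<open>u\<close> is related to
      \<open>w\<close>, so some \<open>\<alpha> \<in> u\<close> has
      \<open>Win \<alpha> \<in> w\<close>, contrary to the choice of \<open>u\<close>.\<close>
    then show False using assms related canonical_rel_iff(1) by blast
  qed
qed

lemma WinInv_in_mcs_iff: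
  assumes "L1.mcs u"
  shows "WinInv \<psi> \<in> u \<longleftrightarrow> (\<forall>w. L2.mcs w \<longrightarrow> \<psi> \<in> w \<longrightarrow> (Inr w, Inl u) \<in> canonical_rel)"
proof
  assume "WinInv \<psi> \<in> u"
  then show "\<forall>w. L2.mcs w \<longrightarrow> \<psi> \<in> w \<longrightarrow> (Inr w, Inl u) \<in> canonical_rel"
    using assms canonical_rel_iff(2) by blast
next
  assume related: "\<forall>w. L2.mcs w \<longrightarrow> \<psi> \<in> w \<longrightarrow> (Inr w, Inl u) \<in> canonical_rel"
  show "WinInv \<psi> \<in> u"
  proof (rule ccontr)
    assume "WinInv \<psi> \<notin> u"
    with assms obtain w where "L2.mcs w" "\<psi> \<in> w" "\<forall>\<alpha>. WinInv \<alpha> \<in> u \<longrightarrow> \<alpha> \<notin> w"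
      by (rule WinInv.unrelated_world)
    then show False using assms related canonical_rel_iff(2) by blast
  qed
qed

lemma truth_lemma:
  fixes \<phi> :: "('p, 'q) fm1" and \<psi> :: "('p, 'q) fm2"
  shows sat1_canonical_model: "L1.mcs u \<Longrightarrow> sat1 canonical_model (Inl u) \<phi> \<longleftrightarrow> \<phi> \<in> u"
    and sat2_canonical_model: "L2.mcs w \<Longrightarrow> sat2 canonical_model (Inr w) \<psi> \<longleftrightarrow> \<psi> \<in> w"
proof (induction \<phi> and \<psi> arbitrary: u and w)
  case (WinInv \<psi>)
  then show ?case
    by (auto simp: WinInv_in_mcs_iff canonical_model_def)
next
  case (Win \<phi>)
  then show ?case
    by (auto simp: Win_in_mcs_iff canonical_model_def)
qed (auto simp: canonical_model_def L1.mcs_neg L2.mcs_neg L1.mcs_conj L2.mcs_conj)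

text \<open>A world extending \<open>\<Phi>\<close> and omitting \<open>\<phi>\<close> is a
  counterexample in the canonical model. Lindenbaum's lemma handles infinite \<open>\<Phi>\<close>,
  which makes the completeness strong.\<close>

lemma proves1_complete:
  assumes "entails1 TYPE(('p, 'q) world) \<Phi> \<phi>"
  shows "proves1 \<Phi> (\<phi> :: ('p, 'q) fm1)"
proof (rule ccontr)
  assume "\<not> proves1 \<Phi> \<phi>"
  then have "\<not> L1.proves \<Phi> \<phi>" unfolding proves1_def L1.proves_def .
  then obtain u where u: "L1.mcs u" "\<Phi> \<subseteq> u" "\<phi> \<notin> u" by (rule L1.lindenbaum)
  then have "Inl u \<in> W1 canonical_model" by (simp add: canonical_model_def)
  moreover have "\<forall>\<chi>\<in>\<Phi>. sat1 canonical_model (Inl u) \<chi>" "\<not> sat1 canonical_model (Inl u) \<phi>"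
    using u by (auto simp: sat1_canonical_model)
  ultimately show False
    using assms canonical_model unfolding entails1_def by blast
qed

lemma proves2_complete:
  assumes "entails2 TYPE(('p, 'q) world) \<Phi> \<phi>"
  shows "proves2 \<Phi> (\<phi> :: ('p, 'q) fm2)"
proof (rule ccontr)
  assume "\<not> proves2 \<Phi> \<phi>"
  then have "\<not> L2.proves \<Phi> \<phi>" unfolding proves2_def L2.proves_def .
  then obtain w where w: "L2.mcs w" "\<Phi> \<subseteq> w" "\<phi> \<notin> w" by (rule L2.lindenbaum)
  then have "Inr w \<in> W2 canonical_model" by (simp add: canonical_model_def)
  moreover have "\<forall>\<chi>\<in>\<Phi>. sat2 canonical_model (Inr w) \<chi>" "\<not> sat2 canonical_model (Inr w) \<phi>"
    using w by (auto simp: sat2_canonical_model)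
  ultimately show False
    using assms canonical_model unfolding entails2_def by blast
qed

theorem theorem6:
  shows "(\<forall>(\<Phi> :: ('p, 'q) fm1 set) (\<phi> :: ('p, 'q) fm1).
            (proves1 \<Phi> \<phi> \<longrightarrow> entails1 TYPE('w) \<Phi> \<phi>) \<and>
            (proves1 \<Phi> \<phi> \<longleftrightarrow> entails1 TYPE(('p, 'q) world) \<Phi> \<phi>)) \<and>
         (\<forall>(\<Psi> :: ('p, 'q) fm2 set) (\<psi> :: ('p, 'q) fm2).
            (proves2 \<Psi> \<psi> \<longrightarrow> entails2 TYPE('w) \<Psi> \<psi>) \<and>
            (proves2 \<Psi> \<psi> \<longleftrightarrow> entails2 TYPE(('p, 'q) world) \<Psi> \<psi>))"
  by (intro conjI allI impI iffI)
    (rule proves1_sound proves1_complete proves2_sound proves2_complete; assumption)+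

end
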